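(* Assume (A.2). Then for every $\xi\in\mathbb{R}$, \[ \operatorname{s-lim}_{t\to\infty}\exp\Big(i\xi\frac{\hat x_0(t)}{t}\Big)=\exp(i\xi\hat v_0). \]
   Context: $\mathcal{H}=\ell^2(\mathbb{Z};\mathbb{C}^2)$; shift $(S\Psi)(x)=(\Psi^{(0)}(x+1),\Psi^{(1)}(x-1))^T$; for $C_0\in U(2)$, $U_0=SC_0$ where $C_0$ acts pointwise. For $k\in[0,2\pi)$ let $\hat U_0(k)=\operatorname{diag}(e^{ik},e^{-ik})C_0$, and write $\hat U_0(k)=\sum_{j=1,2}\lambda_j(k)|u_j(k)\rangle\langle u_j(k)|$ with eigenvalues $\lambda_j(k)$ (differentiable in $k$, $|\lambda_j(k)|=1$) and orthonormal eigenvectors $u_j(k)$. Condition (A.2): $k\mapsto u_j(k)$ is continuously differentiable for $j=1,2$ with $\sup_{k\in[0,2\pi)}\|\frac{d}{dk}u_j(k)\|_{\mathbb{C}^2}<\infty$. Let $\mathcal{K}=L^2([0,2\pi),\frac{dk}{2\pi};\mathbb{C}^2)$ and $\mathscr{F}:\mathcal{H}\to\mathcal{K}$, $(\mathscr{F}\Psi)(k)=\sum_{x\in\mathbb{Z}}e^{-ikx}\Psi(x)$. The asymptotic velocity is $\hat v_0=\mathscr{F}^{-1}M\mathscr{F}$, where $M$ is multiplication by the Hermitian matrix function $\sum_{j=1,2}\frac{i\lambda_j'(k)}{\lambda_j(k)}|u_j(k)\rangle\langle u_j(k)|$. The position operator is $(\hat x\Psi)(x)=x\Psi(x)$ on $D(\hat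 x)=\{\Psi:\sum_x|x|^2\|\Psi(x)\|^2<\infty\}$, and $\hat x_0(t)=U_0^{-t}\hat xU_0^t$ for $t\in\mathbb{N}$. *)

theory Defs
  imports "HOL-Analysis.Analysis"
begin

text \<open>Hilbert space vectors: functions int => complex^2; components Psi^(0) = $1, Psi^(1) = $2.\<close>

type_synonym qstate = "int \<Rightarrow> complex ^ 2"

definition in_l2 :: "qstate \<Rightarrow> bool" where
  "in_l2 \<Psi> \<longleftrightarrow> (\<lambda>x. (norm (\<Psi> x))\<^sup>2) summable_on UNIV"

definition l2_normsq :: "qstate \<Rightarrow> real" where
  "l2_normsq \<Psi> = (\<Sum>\<^sub>\<infinity>x. (norm (\<Psi> x))\<^sup>2)"

definition cinner :: "complex ^ 2 \<Rightarrow> complex ^ 2 \<Rightarrow> complex" where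
  "cinner u v = (\<Sum>i\<in>UNIV. cnj (u $ i) * v $ i)"

definition cadj :: "complex ^ 2 ^ 2 \<Rightarrow> complex ^ 2 ^ 2" where
  "cadj A = (\<chi> i j. cnj (A $ j $ i))"

definition unitary2 :: "complex ^ 2 ^ 2 \<Rightarrow> bool" where
  "unitary2 A \<longleftrightarrow> A ** cadj A = mat 1 \<and> cadj A ** A = mat 1"

definition shift :: "qstate \<Rightarrow> qstate" where
  "shift \<Psi> x = (\<chi> i. if i = 1 then \<Psi> (x + 1) $ 1 else \<Psi> (x - 1) $ 2)"

definition shift_inv :: "qstate \<Rightarrow> qstate" where
  "shift_inv \<Psi> x = (\<chi> i. if i = 1 then \<Psi> (x - 1) $ 1 else \<Psi> (x + 1) $ 2)"

definition coin_op :: "complex ^ 2 ^ 2 \<Rightarrow> qstate \<Rightarrow> qstate" where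
  "coin_op C \<Psi> x = C *v \<Psi> x"

definition walk :: "complex ^ 2 ^ 2 \<Rightarrow> qstate \<Rightarrow> qstate" where
  "walk C = shift \<circ> coin_op C"

text \<open>U_0^{-1} = C_0^{-1} S^{-1} = C_0^* S^{-1} (C_0 unitary).\<close>
definition walk_inv :: "complex ^ 2 ^ 2 \<Rightarrow> qstate \<Rightarrow> qstate" where
  "walk_inv C = coin_op (cadj C) \<circ> shift_inv"

definition exp_pos :: "real \<Rightarrow> real \<Rightarrow> qstate \<Rightarrow> qstate" where
  "exp_pos \<xi> s \<Psi> x = exp (\<i> * complex_of_real (\<xi> * real_of_int x / s)) *s \<Psi> x"

text \<open>exp(i xi xhat_0(t)/t) = U_0^{-t} exp(i xi xhat/t) U_0^t.\<close>
definition exp_pos_heis :: "complex ^ 2 ^ 2 \<Rightarrow> real \<Rightarrow> nat \<Rightarrow> qstate \<Rightarrow> qstate" where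
  "exp_pos_heis C \<xi> t \<Psi> = (walk_inv C ^^ t) (exp_pos \<xi> (real t) ((walk C ^^ t) \<Psi>))"

definition Uhat :: "complex ^ 2 ^ 2 \<Rightarrow> real \<Rightarrow> complex ^ 2 ^ 2" where
  "Uhat C k = (\<chi> i j. (if i = 1 then exp (\<i> * complex_of_real k) else exp (- \<i> * complex_of_real k)) * C $ i $ j)"

definition fourier_inv :: "(real \<Rightarrow> complex ^ 2) \<Rightarrow> qstate" where
  "fourier_inv f x = (\<chi> i. complex_of_real (1 / (2 * pi)) *
      (LINT k:{0..<2*pi}|lborel. exp (\<i> * complex_of_real (k * real_of_int x)) * f k $ i))"

definition sq_integrable :: "(real \<Rightarrow> complex ^ 2) \<Rightarrow> bool" where
  "sq_integrable f \<longleftrightarrow> f \<in> borel_measurable lborel \<and>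
      set_integrable lborel {0..<2*pi} (\<lambda>k. (norm (f k))\<^sup>2)"

text \<open>Pointwise exp(i xi M(k)) for M(k) = sum_j (i lam_j'(k)/lam_j(k)) |u_j(k)><u_j(k)|,
  computed via the spectral decomposition of the Hermitian matrix M(k).\<close>
definition exp_vel_symbol ::
  "(nat \<Rightarrow> real \<Rightarrow> complex) \<Rightarrow> (nat \<Rightarrow> real \<Rightarrow> complex) \<Rightarrow> (nat \<Rightarrow> real \<Rightarrow> complex ^ 2)
     \<Rightarrow> real \<Rightarrow> real \<Rightarrow> complex ^ 2 ^ 2" where
  "exp_vel_symbol lam lam' u \<xi> k = (\<chi> i j. \<Sum>m\<in>{1,2}.
      exp (\<i> * complex_of_real \<xi> * (\<i> * lam' m k / lam m k)) * u m k $ i * cnj (u m k $ j))"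

text \<open>exp(i xi vhat_0) applied to F^{-1} f equals F^{-1}(exp(i xi M) f).\<close>
definition exp_vel_fourier ::
  "(nat \<Rightarrow> real \<Rightarrow> complex) \<Rightarrow> (nat \<Rightarrow> real \<Rightarrow> complex) \<Rightarrow> (nat \<Rightarrow> real \<Rightarrow> complex ^ 2)
     \<Rightarrow> real \<Rightarrow> (real \<Rightarrow> complex ^ 2) \<Rightarrow> real \<Rightarrow> complex ^ 2" where
  "exp_vel_fourier lam lam' u \<xi> f k = exp_vel_symbol lam lam' u \<xi> k *v f k"

end

theory Submission
  imports Defs
begin

text \<open>
  Write \<open>E\<close> for multiplication by \<open>exp (i \<xi> x / t)\<close>, \<open>U\<close> for the walk and \<open>A(k)\<close> for its symbol
  \<^term>\<open>Uhat C0 k\<close>. Conjugation by \<open>E\<close> only changes the coin: \<open>E U E\<^sup>-\<^sup>1\<close> is again a walk \<open>U\<^sub>t\<close>, with the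
  translated symbol \<open>A(k - \<xi>/t)\<close>. Hence for \<open>\<psi> = F\<^sup>-\<^sup>1 f\<close>, where \<open>F\<close> is the Fourier transform and \<open>V(k)\<close>
  the symbol of the limit,
  \<open>U\<^sup>-\<^sup>t E U\<^sup>t \<psi> - F\<^sup>-\<^sup>1 V f = U\<^sup>-\<^sup>t U\<^sub>t\<^sup>t (E \<psi> - \<psi>) + F\<^sup>-\<^sup>1 (A(k)\<^sup>-\<^sup>t A(k - \<xi>/t)\<^sup>t f - V f)\<close>.
  The first term tends to zero because walks are isometric and \<open>E \<psi> \<rightarrow> \<psi>\<close> by dominated convergence on the
  position side. The second one is controlled by Bessel's inequality and dominated convergence on the
  momentum side: \<open>A(k)\<^sup>-\<^sup>t A(k - \<xi>/t)\<^sup>t u\<^sub>j(k)\<close> differs from \<open>(\<lambda>\<^sub>j(k - \<xi>/t) / \<lambda>\<^sub>j(k))\<^sup>t u\<^sub>j(k)\<close> by at most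
  \<open>2 \<parallel>u\<^sub>j(k) - u\<^sub>j(k - \<xi>/t)\<parallel>\<close>, and the scalar factor tends to \<open>exp (- \<xi> \<lambda>\<^sub>j'(k) / \<lambda>\<^sub>j(k))\<close>. In this way neither
  Plancherel's theorem nor the continuity of translations in \<open>L\<^sup>2\<close> is needed.
\<close>

subsection \<open>Unitary matrices\<close>

lemma norm_sq_vec2: "(norm (v :: complex ^ 2))\<^sup>2 = (norm (v $ 1))\<^sup>2 + (norm (v $ 2))\<^sup>2"
  by (simp add: norm_vec_def L2_set_def sum_2)

lemma norm_vector_scalar_mult: "norm (c *s (v :: complex ^ 2)) = norm c * norm v"
proof -
  have "(norm (c *s v))\<^sup>2 = (norm c * norm v)\<^sup>2"
    by (simp add: norm_sq_vec2 norm_mult power_mult_distrib algebra_simps)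
  then show ?thesis by (simp add: power2_eq_iff_nonneg)
qed

lemma norm_diff_sq_le:
  fixes a b :: "'a :: real_normed_vector"
  shows "(norm (a - b))\<^sup>2 \<le> 2 * (norm a)\<^sup>2 + 2 * (norm b)\<^sup>2"
proof -
  have "(norm (a - b))\<^sup>2 \<le> (norm a + norm b)\<^sup>2"
    by (intro power_mono norm_triangle_ineq4) auto
  also have "\<dots> \<le> 2 * (norm a)\<^sup>2 + 2 * (norm b)\<^sup>2"
    using sum_squares_bound[of "norm a" "norm b"] by (simp add: power2_sum)
  finally show ?thesis .
qed

lemma norm_add_sq_le:
  fixes a b :: "'a :: real_normed_vector"
  shows "(norm (a + b))\<^sup>2 \<le> 2 * (norm a)\<^sup>2 + 2 * (norm b)\<^sup>2"
  using norm_diff_sq_le[of a "- b"] by simp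

lemma cinner_self: "cinner v v = complex_of_real ((norm v)\<^sup>2)"
  by (simp add: cinner_def sum_2 norm_sq_vec2 complex_norm_square mult.commute del: of_real_power)

lemma cinner_cadj: "cinner (A *v v) w = cinner v (cadj A *v w)"
  by (simp add: cinner_def cadj_def matrix_vector_mult_def sum_2 algebra_simps)

lemma norm_unitary2_mult:
  assumes "unitary2 A"
  shows "norm (A *v v) = norm v"
proof -
  have "cinner (A *v v) (A *v v) = cinner v v"
    using assms by (simp add: cinner_cadj matrix_vector_mul_assoc unitary2_def)
  then have "complex_of_real ((norm (A *v v))\<^sup>2) = complex_of_real ((norm v)\<^sup>2)"
    by (simp only: cinner_self)
  then have "(norm (A *v v))\<^sup>2 = (norm v)\<^sup>2"
    using of_real_eq_iff by blast
  then show ?thesis by (simp add: power2_eq_iff_nonneg)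
qed

lemma cadj_cadj: "cadj (cadj A) = A"
  by (simp add: cadj_def vec_eq_iff)

lemma unitary2_cadj: "unitary2 A \<Longrightarrow> unitary2 (cadj A)"
  by (simp add: unitary2_def cadj_cadj)

lemma unitary2_Uhat:
  assumes "unitary2 C"
  shows "unitary2 (Uhat C k)"
proof -
  have [simp]: "exp (\<i> * k) * exp (- (\<i> * k)) = 1" "exp (- (\<i> * k)) * exp (\<i> * k) = 1" for k :: complex
    by (simp_all flip: exp_add)
  \<comment> \<open>In this order every phase meets its own conjugate and cancels. The opposite
    product would leave phases in the off-diagonal entries, so it is recovered from the fact that
    one-sided inverses of square matrices are two-sided.\<close>
  have 1: "cadj (Uhat C k) ** Uhat C k = cadj C ** C"
    by (simp add: vec_eq_iff matrix_matrix_mult_def cadj_def Uhat_def sum_2 forall_2 exp_cnj algebra_simps)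
  have "C ** cadj C = mat 1" "cadj C ** C = mat 1" using assms by (auto simp: unitary2_def)
  have "Uhat C k ** cadj (Uhat C k) = mat 1"
    using 1 \<open>cadj C ** C = mat 1\<close> matrix_left_right_inverse by metis
  then show ?thesis using 1 \<open>cadj C ** C = mat 1\<close> by (simp add: unitary2_def)
qed

lemma norm_funpow_unitary2: "unitary2 A \<Longrightarrow> norm (((*v) A ^^ t) v) = norm v"
  by (induction t) (simp_all add: norm_unitary2_mult)

lemma funpow_matrix_diff:
  fixes A :: "complex ^ 2 ^ 2"
  shows "((*v) A ^^ t) (v - w) = ((*v) A ^^ t) v - ((*v) A ^^ t) w"
  by (induction t) (simp_all add: matrix_vector_mult_diff_distrib)

lemma funpow_matrix_add:
  fixes A :: "complex ^ 2 ^ 2"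
  shows "((*v) A ^^ t) (v + w) = ((*v) A ^^ t) v + ((*v) A ^^ t) w"
  by (induction t) (simp_all add: matrix_vector_right_distrib)

lemma funpow_matrix_scale:
  fixes A :: "complex ^ 2 ^ 2"
  shows "((*v) A ^^ t) (c *s v) = c *s ((*v) A ^^ t) v"
  by (induction t) (simp_all add: vector_scalar_commute)

lemma funpow_matrix_eigen:
  fixes A :: "complex ^ 2 ^ 2"
  assumes "A *v v = c *s v"
  shows "((*v) A ^^ t) v = c ^ t *s v"
  by (induction t) (simp_all add: assms vector_scalar_commute mult.commute)

subsection \<open>Square-summable states\<close>

lemma in_l2_component:
  assumes "in_l2 \<Psi>"
  shows "(\<lambda>x. (norm (\<Psi> x $ i))\<^sup>2) summable_on UNIV"
  using assms unfolding in_l2_def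
  by (rule summable_on_comparison_test) (auto intro: power_mono Finite_Cartesian_Product.norm_nth_le)

lemma l2_normsq_components:
  assumes "in_l2 \<Psi>"
  shows "l2_normsq \<Psi> = (\<Sum>\<^sub>\<infinity>x. (norm (\<Psi> x $ 1))\<^sup>2) + (\<Sum>\<^sub>\<infinity>x. (norm (\<Psi> x $ 2))\<^sup>2)"
  unfolding l2_normsq_def norm_sq_vec2 by (intro infsum_add in_l2_component assms)

text \<open>The squared norm splits into one sum per component, and each sum is invariant under
  reindexing. Two bijections are allowed because the shift moves the components in opposite
  directions.\<close>

lemma l2_bij_components:
  assumes "in_l2 \<Psi>" and g: "bij g" and h: "bij h"
    and \<Phi>: "\<And>x. \<Phi> x $ 1 = \<Psi> (g x) $ 1" "\<And>x. \<Phi> x $ 2 = \<Psi> (h x) $ 2"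
  shows "in_l2 \<Phi>" "l2_normsq \<Phi> = l2_normsq \<Psi>"
proof -
  have s: "(\<lambda>x. (norm (\<Psi> (g x) $ 1))\<^sup>2) summable_on UNIV" "(\<lambda>x. (norm (\<Psi> (h x) $ 2))\<^sup>2) summable_on UNIV"
    using in_l2_component[OF assms(1)]
    by (simp_all add: summable_on_reindex_bij_betw[OF g, of "\<lambda>x. (norm (\<Psi> x $ 1))\<^sup>2"]
        summable_on_reindex_bij_betw[OF h, of "\<lambda>x. (norm (\<Psi> x $ 2))\<^sup>2"])
  show *: "in_l2 \<Phi>"
    unfolding in_l2_def norm_sq_vec2 \<Phi> by (intro summable_on_add s)
  show "l2_normsq \<Phi> = l2_normsq \<Psi>"
    unfolding l2_normsq_components[OF *] l2_normsq_components[OF assms(1)] \<Phi>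
    by (intro arg_cong2[where f="(+)"] infsum_reindex_bij_betw[OF g, of "\<lambda>x. (norm (\<Psi> x $ 1))\<^sup>2"]
        infsum_reindex_bij_betw[OF h, of "\<lambda>x. (norm (\<Psi> x $ 2))\<^sup>2"])
qed

lemma bij_int_shift: "bij (\<lambda>x :: int. x + c)" "bij (\<lambda>x :: int. x - c)"
  by (rule bij_betwI[where g="\<lambda>x. x - c"]; simp) (rule bij_betwI[where g="\<lambda>x. x + c"]; simp)

lemma l2_shift:
  assumes "in_l2 \<Psi>"
  shows "in_l2 (shift \<Psi>)" "l2_normsq (shift \<Psi>) = l2_normsq \<Psi>"
  by (rule l2_bij_components[OF assms bij_int_shift(1)[of 1] bij_int_shift(2)[of 1]]; simp add: shift_def)+

lemma l2_shift_inv: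
  assumes "in_l2 \<Psi>"
  shows "in_l2 (shift_inv \<Psi>)" "l2_normsq (shift_inv \<Psi>) = l2_normsq \<Psi>"
  by (rule l2_bij_components[OF assms bij_int_shift(2)[of 1] bij_int_shift(1)[of 1]]; simp add: shift_inv_def)+

lemma l2_coin_op:
  assumes "unitary2 C"
  shows "in_l2 (coin_op C \<Psi>) = in_l2 \<Psi>" "l2_normsq (coin_op C \<Psi>) = l2_normsq \<Psi>"
  using assms by (simp_all add: in_l2_def l2_normsq_def coin_op_def norm_unitary2_mult)

lemma l2_funpow_walk:
  assumes "unitary2 C" "in_l2 \<Psi>"
  shows "in_l2 ((walk C ^^ t) \<Psi>) \<and> l2_normsq ((walk C ^^ t) \<Psi>) = l2_normsq \<Psi>"
  using assms by (induction t) (simp_all add: walk_def l2_shift l2_coin_op)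

lemma l2_funpow_walk_inv:
  assumes "unitary2 C" "in_l2 \<Psi>"
  shows "in_l2 ((walk_inv C ^^ t) \<Psi>) \<and> l2_normsq ((walk_inv C ^^ t) \<Psi>) = l2_normsq \<Psi>"
  using assms by (induction t) (simp_all add: walk_inv_def l2_shift_inv l2_coin_op unitary2_cadj)

lemma funpow_walk_diff:
  "(walk C ^^ t) (\<lambda>x. \<Psi> x - \<Phi> x) = (\<lambda>x. (walk C ^^ t) \<Psi> x - (walk C ^^ t) \<Phi> x)"
proof (induction t)
  case (Suc t)
  have "walk C (\<lambda>x. \<Psi> x - \<Phi> x) = (\<lambda>x. walk C \<Psi> x - walk C \<Phi> x)" for \<Psi> \<Phi>
    by (simp add: walk_def shift_def coin_op_def fun_eq_iff vec_eq_iff matrix_vector_mult_diff_distrib)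
  then show ?case by (simp add: Suc)
qed simp

lemma funpow_walk_inv_diff:
  "(walk_inv C ^^ t) (\<lambda>x. \<Psi> x - \<Phi> x) = (\<lambda>x. (walk_inv C ^^ t) \<Psi> x - (walk_inv C ^^ t) \<Phi> x)"
proof (induction t)
  case (Suc t)
  have "shift_inv (\<lambda>x. \<Psi> x - \<Phi> x) x = shift_inv \<Psi> x - shift_inv \<Phi> x" for \<Psi> \<Phi> x
    by (simp add: shift_inv_def vec_eq_iff)
  then have "walk_inv C (\<lambda>x. \<Psi> x - \<Phi> x) = (\<lambda>x. walk_inv C \<Psi> x - walk_inv C \<Phi> x)" for \<Psi> \<Phi>
    by (simp add: walk_inv_def coin_op_def fun_eq_iff matrix_vector_mult_diff_distrib)
  then show ?case by (simp add: Suc)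
qed simp

lemma l2_diff:
  assumes "in_l2 \<Psi>" "in_l2 \<Phi>"
  shows "in_l2 (\<lambda>x. \<Psi> x - \<Phi> x)"
  unfolding in_l2_def
proof (rule summable_on_comparison_test)
  show "(\<lambda>x. 2 * (norm (\<Psi> x))\<^sup>2 + 2 * (norm (\<Phi> x))\<^sup>2) summable_on UNIV"
    using assms unfolding in_l2_def by (intro summable_on_add summable_on_cmult_right)
qed (simp_all add: norm_diff_sq_le)

text \<open>The crude pointwise bound |a + b|^2 \<le> 2|a|^2 + 2|b|^2 replaces Minkowski's
  inequality; it suffices for adding two errors that both tend to zero.\<close>

lemma l2_add:
  assumes "in_l2 \<Psi>" "in_l2 \<Phi>"
  shows "in_l2 (\<lambda>x. \<Psi> x + \<Phi> x)"
    and "l2_normsq (\<lambda>x. \<Psi> x + \<Phi> x) \<le> 2 * l2_normsq \<Psi> + 2 * l2_normsq \<Phi>"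
proof -
  have s: "(\<lambda>x. (norm (\<Psi> x))\<^sup>2) summable_on UNIV" "(\<lambda>x. (norm (\<Phi> x))\<^sup>2) summable_on UNIV"
    using assms unfolding in_l2_def by auto
  then have s2: "(\<lambda>x. 2 * (norm (\<Psi> x))\<^sup>2 + 2 * (norm (\<Phi> x))\<^sup>2) summable_on UNIV"
    by (intro summable_on_add summable_on_cmult_right)
  show *: "in_l2 (\<lambda>x. \<Psi> x + \<Phi> x)"
    unfolding in_l2_def using s2
    by (rule summable_on_comparison_test) (simp_all add: norm_add_sq_le)
  have "l2_normsq (\<lambda>x. \<Psi> x + \<Phi> x) \<le> (\<Sum>\<^sub>\<infinity>x. 2 * (norm (\<Psi> x))\<^sup>2 + 2 * (norm (\<Phi> x))\<^sup>2)"
    unfolding l2_normsq_def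
    by (rule infsum_mono) (use * s2 in \<open>auto simp: in_l2_def norm_add_sq_le\<close>)
  also have "\<dots> = 2 * l2_normsq \<Psi> + 2 * l2_normsq \<Phi>"
    unfolding l2_normsq_def using s
    by (subst infsum_add) (simp_all add: summable_on_cmult_right infsum_cmult_right')
  finally show "l2_normsq (\<lambda>x. \<Psi> x + \<Phi> x) \<le> 2 * l2_normsq \<Psi> + 2 * l2_normsq \<Phi>" .
qed

section \<open>Position phases: convergence to the identity and conjugation of the walk\<close>

lemma l2_exp_pos: "in_l2 \<Psi> \<Longrightarrow> in_l2 (exp_pos \<xi> s \<Psi>)"
  by (simp add: in_l2_def exp_pos_def norm_vector_scalar_mult)

text \<open>Domination by \<open>M\<close> gives absolute summability, which identifies each
  \<open>infsum\<close> with a Bochner integral over counting measure; the dominated convergence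
  theorem then applies.\<close>

lemma infsum_tendsto_dominated:
  fixes F :: "nat \<Rightarrow> 'a :: countable \<Rightarrow> real"
  assumes "M summable_on UNIV" and bound: "\<And>n x. \<bar>F n x\<bar> \<le> M x"
    and lim: "\<And>x. (\<lambda>n. F n x) \<longlonglongrightarrow> G x"
  shows "(\<lambda>n. infsum (F n) UNIV) \<longlonglongrightarrow> infsum G UNIV"
proof -
  have boundG: "\<bar>G x\<bar> \<le> M x" for x
    by (rule LIMSEQ_le_const2[OF tendsto_rabs[OF lim]]) (use bound in blast)
  have M0: "0 \<le> M x" for x using bound[of 0 x] by linarith
  have *: "integrable (count_space UNIV) H \<and> infsum H UNIV = integral\<^sup>L (count_space UNIV) H"
    if "\<And>x. \<bar>H x\<bar> \<le> M x" for H :: "'a \<Rightarrow> real"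
  proof -
    have "(\<lambda>x. norm (H x)) summable_on UNIV"
      by (rule summable_on_comparison_test[OF assms(1)]) (use that in auto)
    then have "Infinite_Set_Sum.abs_summable_on H UNIV" by (simp only: abs_summable_equivalent)
    then show ?thesis
      by (simp add: infsetsum_infsum[symmetric] infsetsum_def Infinite_Set_Sum.abs_summable_on_def)
  qed
  have "(\<lambda>n. integral\<^sup>L (count_space UNIV) (F n)) \<longlonglongrightarrow> integral\<^sup>L (count_space UNIV) G"
    by (rule integral_dominated_convergence[where w=M])
       (use bound lim * M0 in \<open>auto\<close>)
  then show ?thesis using * bound boundG by simp
qed

lemma tendsto_divide_nat: "(\<lambda>t. \<xi> / real t) \<longlonglongrightarrow> 0"
  by (rule tendsto_divide_0[OF tendsto_const])
     (simp add: filterlim_real_sequentially filterlim_at_top_imp_at_infinity)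

text \<open>At each fixed site the phase tends to 1, and 4 |\<Psi>(x)|^2 dominates the squared
  difference because the phases have modulus 1.\<close>

lemma exp_pos_tendsto:
  assumes "in_l2 \<Psi>"
  shows "(\<lambda>t. l2_normsq (\<lambda>x. exp_pos \<xi> (real t) \<Psi> x - \<Psi> x)) \<longlonglongrightarrow> 0"
proof -
  have "(\<lambda>t. \<Sum>\<^sub>\<infinity>x. (norm (exp_pos \<xi> (real t) \<Psi> x - \<Psi> x))\<^sup>2) \<longlonglongrightarrow> (\<Sum>\<^sub>\<infinity>x::int. 0)"
  proof (rule infsum_tendsto_dominated)
    show "(\<lambda>x. 4 * (norm (\<Psi> x))\<^sup>2) summable_on UNIV"
      using assms unfolding in_l2_def by (rule summable_on_cmult_right)
    show "\<bar>(norm (exp_pos \<xi> (real t) \<Psi> x - \<Psi> x))\<^sup>2\<bar> \<le> 4 * (norm (\<Psi> x))\<^sup>2" for t x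
      using norm_diff_sq_le[of "exp_pos \<xi> (real t) \<Psi> x" "\<Psi> x"]
      by (simp add: exp_pos_def norm_vector_scalar_mult)
    show "(\<lambda>t. (norm (exp_pos \<xi> (real t) \<Psi> x - \<Psi> x))\<^sup>2) \<longlonglongrightarrow> 0" for x
    proof -
      have 1: "(\<lambda>t. \<xi> * real_of_int x / real t) \<longlonglongrightarrow> 0"
        by (rule tendsto_divide_nat)
      have "(\<lambda>t. (norm ((exp (\<i> * complex_of_real (\<xi> * real_of_int x / real t)) - 1)) * norm (\<Psi> x))\<^sup>2)
         \<longlonglongrightarrow> (norm (exp (\<i> * complex_of_real 0) - 1) * norm (\<Psi> x))\<^sup>2"
        by (intro tendsto_intros 1)
      moreover have "exp_pos \<xi> (real t) \<Psi> x - \<Psi> x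
         = (exp (\<i> * complex_of_real (\<xi> * real_of_int x / real t)) - 1) *s \<Psi> x" for t
        by (simp only: exp_pos_def vector_sub_rdistrib vector_smult_lid)
      ultimately show ?thesis by (simp only: norm_vector_scalar_mult) simp
    qed
  qed
  then show ?thesis by (simp add: l2_normsq_def)
qed

text \<open>The shift moves amplitude by one site, so the phases at source and target differ by a
  constant: exp (- i \<xi> / s) in the first component and its inverse in the second. This diagonal
  factor is absorbed into the coin.\<close>

lemma exp_pos_walk: "exp_pos \<xi> s (walk C \<Psi>) = walk (Uhat C (- \<xi> / s)) (exp_pos \<xi> s \<Psi>)"
proof (intro ext iffD2[OF vec_eq_iff] allI)
  fix x and i :: 2
  have e1: "exp (\<i> * complex_of_real (\<xi> * real_of_int x / s)) =
      exp (\<i> * complex_of_real (- \<xi> / s)) * exp (\<i> * complex_of_real (\<xi> * real_of_int (x + 1) / s))"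
    by (simp flip: exp_add) (simp add: field_simps add_divide_distrib)
  have e2: "exp (\<i> * complex_of_real (\<xi> * real_of_int x / s)) =
      exp (- \<i> * complex_of_real (- \<xi> / s)) * exp (\<i> * complex_of_real (\<xi> * real_of_int (x - 1) / s))"
    by (simp flip: exp_add) (simp add: field_simps diff_divide_distrib)
  show "exp_pos \<xi> s (walk C \<Psi>) x $ i = walk (Uhat C (- \<xi> / s)) (exp_pos \<xi> s \<Psi>) x $ i"
  proof (cases "i = 1")
    case True
    then show ?thesis
      unfolding exp_pos_def walk_def shift_def coin_op_def o_def Uhat_def matrix_vector_mult_def
      using e1 by (simp add: sum_2 algebra_simps)
  next
    case False
    then show ?thesis
      unfolding exp_pos_def walk_def shift_def coin_op_def o_def Uhat_def matrix_vector_mult_def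
      using e2 by (simp add: sum_2 algebra_simps)
  qed
qed

lemma exp_pos_funpow_walk:
  "exp_pos \<xi> s ((walk C ^^ t) \<Psi>) = (walk (Uhat C (- \<xi> / s)) ^^ t) (exp_pos \<xi> s \<Psi>)"
  by (induction t) (simp_all add: exp_pos_walk)

text \<open>The diagonal phases multiply. Hence the modified coin of the conjugated walk amounts to
  a translation of the original symbol in momentum.\<close>

lemma Uhat_Uhat: "Uhat (Uhat C h) k = Uhat C (k + h)"
  by (simp add: Uhat_def vec_eq_iff exp_add exp_diff exp_minus field_simps)

subsection \<open>Fourier series on the circle\<close>

text \<open>The measure has total mass 2 pi; the normalising factor 1 / (2 pi) is written out
  wherever it occurs.\<close>

definition circ :: "real measure" where
  "circ = restrict_space lborel {0..<2*pi}"

definition L2_circ :: "(real \<Rightarrow> complex ^ 2) \<Rightarrow> bool" where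
  "L2_circ f \<longleftrightarrow> f \<in> borel_measurable circ \<and> integrable circ (\<lambda>k. (norm (f k))\<^sup>2)"

lemma space_circ: "space circ = {0..<2*pi}"
  by (simp add: circ_def space_restrict_space)

lemma integral_circ:
  fixes h :: "real \<Rightarrow> 'a :: {banach, second_countable_topology}"
  shows "(LINT k:{0..<2*pi}|lborel. h k) = integral\<^sup>L circ h"
  by (simp add: circ_def set_lebesgue_integral_def integral_restrict_space)

lemma finite_measure_circ: "finite_measure circ"
  by (rule finite_measureI) (simp add: space_circ, simp add: circ_def emeasure_restrict_space)

lemma borel_measurable_circ: "h \<in> borel_measurable borel \<Longrightarrow> h \<in> borel_measurable circ"
  by (simp add: circ_def measurable_restrict_space1)

lemma L2_circ_sq_integrable: "sq_integrable f \<Longrightarrow> L2_circ f"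
  unfolding sq_integrable_def L2_circ_def set_integrable_def
  by (simp add: circ_def integrable_restrict_space measurable_restrict_space1)

text \<open>Only the endpoint 0 is removed, a null set. In the interior, derivatives within the
  half-open interval are two-sided.\<close>

lemma AE_circ_interior: "AE k in circ. 0 < k \<and> k < 2 * pi"
proof -
  have "AE k in lborel. k \<noteq> (0::real)" by (rule AE_lborel_singleton)
  then show ?thesis
    unfolding circ_def by (subst AE_restrict_space_iff) (auto elim!: eventually_mono)
qed

lemma integral_circ_exp:
  "integral\<^sup>L circ (\<lambda>k. exp (\<i> * complex_of_real (k * real_of_int n))) = (if n = 0 then 2 * pi else 0)"
proof -
  let ?e = "\<lambda>k. exp (\<i> * complex_of_real (k * real_of_int n))"
  \<comment> \<open>Adding the null point 2 pi yields the closed interval on which the fundamental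
    theorem of calculus is applied.\<close>
  have *: "integral\<^sup>L circ ?e = integral\<^sup>L lborel (\<lambda>k. indicator {0..2*pi} k *\<^sub>R ?e k)"
    unfolding integral_circ[symmetric] set_lebesgue_integral_def[symmetric]
    by (rule set_integral_discrete_difference[where X="{2*pi}"]) auto
  show ?thesis
  proof (cases "n = 0")
    case True
    then show ?thesis unfolding * by (simp add: scaleR_conv_of_real)
  next
    case False
    have "integral\<^sup>L lborel (\<lambda>k. indicator {0..2*pi} k *\<^sub>R ?e k) =
        ?e (2 * pi) / (\<i> * n) - ?e 0 / (\<i> * n)"
    proof (rule integral_FTC_atLeastAtMost)
      fix k
      show "((\<lambda>k. ?e k / (\<i> * n)) has_vector_derivative ?e k) (at k within {0..2 * pi})"
        unfolding of_real_mult
        by (rule has_vector_derivative_real_field) (use False in \<open>auto intro!: derivative_eq_intros simp: mult_ac\<close>)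
    qed (auto intro!: continuous_intros)
    also have "?e (2 * pi) = 1"
      using exp_integer_2pi[of "of_int n"] by (simp add: mult_ac)
    finally show ?thesis using False unfolding * by simp
  qed
qed

lemma integrable_circ_exp: "integrable circ (\<lambda>k. exp (\<i> * complex_of_real (k * real_of_int n)))"
  by (rule finite_measure.integrable_const_bound[OF finite_measure_circ, of _ 1])
     (auto intro!: borel_measurable_circ borel_measurable_continuous_onI continuous_intros)

text \<open>On a finite measure space square-integrable functions are integrable: |g| \<le> 1 +
  |g|^2, and the exponential has modulus 1.\<close>

lemma integrable_circ_exp_mult:
  fixes g :: "real \<Rightarrow> complex"
  assumes g: "g \<in> borel_measurable circ" "integrable circ (\<lambda>k. (norm (g k))\<^sup>2)"
  shows "integrable circ (\<lambda>k. exp (\<i> * complex_of_real (k * y)) * g k)"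
proof (rule Bochner_Integration.integrable_bound)
  show "integrable circ (\<lambda>k. 1 + (norm (g k))\<^sup>2)"
    by (intro Bochner_Integration.integrable_add g(2) finite_measure.integrable_const finite_measure_circ)
  have "(\<lambda>k. exp (\<i> * complex_of_real (k * y))) \<in> borel_measurable circ"
    by (intro borel_measurable_circ borel_measurable_continuous_onI continuous_intros)
  then show "(\<lambda>k. exp (\<i> * complex_of_real (k * y)) * g k) \<in> borel_measurable circ"
    using g(1) by (rule borel_measurable_times)
  have "a \<le> 1 + a\<^sup>2" for a :: real
    using sum_squares_bound[of a 1] zero_le_power2[of a] by (simp; linarith)
  then show "AE k in circ. norm (exp (\<i> * complex_of_real (k * y)) * g k) \<le> norm (1 + (norm (g k))\<^sup>2)"
    by (simp add: norm_mult)
qed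

text \<open>This variant has the exponent in the form to which the simplifier brings it.\<close>

lemma integrable_circ_exp_int_mult:
  fixes g :: "real \<Rightarrow> complex"
  assumes "g \<in> borel_measurable circ" "integrable circ (\<lambda>k. (norm (g k))\<^sup>2)"
  shows "integrable circ (\<lambda>k. exp (\<i> * (complex_of_real k * complex_of_int n)) * g k)"
  using integrable_circ_exp_mult[OF assms, of "real_of_int n"] by simp

text \<open>Bessel's inequality, from nonnegativity of the integral of |g - p|^2, where
  \<open>p\<close> is the Fourier polynomial of \<open>g\<close> with frequencies from
  \<open>X\<close>.\<close>

lemma bessel_circ_finite:
  fixes g :: "real \<Rightarrow> complex"
  assumes g: "g \<in> borel_measurable circ" "integrable circ (\<lambda>k. (norm (g k))\<^sup>2)"
    and "finite X"
  defines "c \<equiv> \<lambda>x::int. 1 / (2 * pi) * integral\<^sup>L circ (\<lambda>k. exp (\<i> * complex_of_real (k * real_of_int x)) * g k)"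
  shows "(\<Sum>x\<in>X. (norm (c x))\<^sup>2) \<le> 1 / (2 * pi) * integral\<^sup>L circ (\<lambda>k. (norm (g k))\<^sup>2)"
proof -
  define e where "e x k = exp (\<i> * complex_of_real (k * real_of_int x))" for x k
  \<comment> \<open>The coefficient \<open>c x\<close> pairs \<open>g\<close> with
    \<open>e x\<close>, as in the inverse transform, so the matching character in the polynomial is
    the conjugate \<open>e (- x)\<close>. Below, \<open>q\<close> is the cross term and
    \<open>r\<close> the squared modulus of \<open>p\<close>.\<close>
  define p where "p k = (\<Sum>x\<in>X. c x * e (- x) k)" for k
  define q where "q k = (\<Sum>x\<in>X. cnj (c x) * (e x k * g k))" for k
  define r where "r k = (\<Sum>x\<in>X. \<Sum>y\<in>X. c x * cnj (c y) * e (y - x) k)" for k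
  define S where "S = (\<Sum>x\<in>X. (norm (c x))\<^sup>2)"
  have cnj_e: "cnj (e (- x) k) = e x k" for x k by (simp add: e_def exp_cnj)
  have e_mult: "e (- x) k * e y k = e (y - x) k" for x y k
    by (simp add: e_def algebra_simps flip: exp_add)
  have pt: "(norm (g k - p k))\<^sup>2 = (norm (g k))\<^sup>2 - 2 * Re (q k) + Re (r k)" for k
  proof -
    have q: "q k = cnj (p k) * g k"
      by (simp add: q_def p_def sum_distrib_right cnj_e mult.assoc)
    have "r k = p k * cnj (p k)"
      by (simp add: r_def p_def sum_product cnj_e flip: e_mult) (simp add: mult_ac)
    then have r: "Re (r k) = (norm (p k))\<^sup>2"
      by (metis complex_norm_square Re_complex_of_real)
    show ?thesis
      unfolding q r cmod_power2 by (simp add: power2_eq_square algebra_simps)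
  qed
  have int_e: "integral\<^sup>L circ (e n) = (if n = 0 then 2 * pi else 0)" for n
    using integral_circ_exp[of n] by (simp only: e_def[abs_def])
  have int_q: "integrable circ q"
    unfolding q_def e_def
    by (intro Bochner_Integration.integrable_sum integrable_mult_right integrable_circ_exp_mult g)
  have int_r: "integrable circ r"
    unfolding r_def e_def
    by (intro Bochner_Integration.integrable_sum integrable_mult_right integrable_circ_exp)
  have c2: "cnj (c x) * integral\<^sup>L circ (\<lambda>k. e x k * g k) = complex_of_real (2 * pi * (norm (c x))\<^sup>2)" for x
  proof -
    have "integral\<^sup>L circ (\<lambda>k. e x k * g k) = 2 * pi * c x" by (simp add: c_def e_def)
    then show ?thesis by (simp add: complex_norm_square mult_ac del: of_real_power)
  qed
  have "integral\<^sup>L circ q = (\<Sum>x\<in>X. cnj (c x) * integral\<^sup>L circ (\<lambda>k. e x k * g k))"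
    unfolding q_def e_def
    by (subst Bochner_Integration.integral_sum)
       (auto intro!: integrable_mult_right integrable_circ_exp_int_mult g)
  also have "\<dots> = complex_of_real (2 * pi * S)"
    unfolding c2 S_def by (simp add: sum_distrib_left)
  finally have iq: "integral\<^sup>L circ q = complex_of_real (2 * pi * S)" .
  have "integral\<^sup>L circ r = (\<Sum>x\<in>X. \<Sum>y\<in>X. c x * cnj (c y) * integral\<^sup>L circ (e (y - x)))"
    unfolding r_def e_def
    by (subst Bochner_Integration.integral_sum, intro Bochner_Integration.integrable_sum integrable_mult_right integrable_circ_exp)
       (intro sum.cong refl, subst Bochner_Integration.integral_sum, auto intro!: integrable_mult_right integrable_circ_exp simp del: of_int_diff of_real_mult)
  also have "\<dots> = (\<Sum>x\<in>X. \<Sum>y\<in>X. if x = y then c x * cnj (c x) * (2 * pi) else 0)"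
    by (intro sum.cong refl) (auto simp: int_e)
  also have "\<dots> = complex_of_real (2 * pi * S)"
    using \<open>finite X\<close> by (simp add: S_def sum_distrib_left complex_norm_square mult_ac del: of_real_power)
  finally have ir: "integral\<^sup>L circ r = complex_of_real (2 * pi * S)" .
  \<comment> \<open>Both \<open>q\<close> and \<open>r\<close> integrate to 2 pi S, so the cross
    term counted twice outweighs the square and - 2 pi S remains.\<close>
  have "0 \<le> integral\<^sup>L circ (\<lambda>k. (norm (g k - p k))\<^sup>2)" by simp
  also have "\<dots> = integral\<^sup>L circ (\<lambda>k. (norm (g k))\<^sup>2) - 2 * Re (integral\<^sup>L circ q) + Re (integral\<^sup>L circ r)"
    unfolding pt using int_q int_r g(2) by simp
  also have "\<dots> = integral\<^sup>L circ (\<lambda>k. (norm (g k))\<^sup>2) - 2 * pi * S"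
    unfolding iq ir by simp
  finally show ?thesis unfolding S_def[symmetric] by (simp add: field_simps)
qed

lemma fourier_inv_nth:
  "fourier_inv f x $ i = 1 / (2 * pi) * integral\<^sup>L circ (\<lambda>k. exp (\<i> * complex_of_real (k * real_of_int x)) * f k $ i)"
  by (simp add: fourier_inv_def integral_circ)

lemma L2_circ_nth:
  assumes "L2_circ f"
  shows "(\<lambda>k. f k $ i) \<in> borel_measurable circ" "integrable circ (\<lambda>k. (norm (f k $ i))\<^sup>2)"
proof -
  have "(\<lambda>v :: complex ^ 2. v $ i) \<in> borel_measurable borel"
    by (intro borel_measurable_continuous_onI continuous_intros)
  then show *: "(\<lambda>k. f k $ i) \<in> borel_measurable circ"
    using assms unfolding L2_circ_def by (auto intro: measurable_compose)
  show "integrable circ (\<lambda>k. (norm (f k $ i))\<^sup>2)"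
    by (rule Bochner_Integration.integrable_bound[of _ "\<lambda>k. (norm (f k))\<^sup>2"])
       (use assms * in \<open>auto simp: L2_circ_def intro!: power_mono Finite_Cartesian_Product.norm_nth_le\<close>)
qed

text \<open>Componentwise Bessel bounds all finite partial sums by the same constant, which gives
  summability and the norm bound at once.\<close>

lemma bessel_fourier_inv:
  assumes "L2_circ f"
  shows "in_l2 (fourier_inv f)"
    and "l2_normsq (fourier_inv f) \<le> 1 / (2 * pi) * integral\<^sup>L circ (\<lambda>k. (norm (f k))\<^sup>2)"
proof -
  have *: "(\<Sum>x\<in>X. (norm (fourier_inv f x))\<^sup>2) \<le> 1 / (2 * pi) * integral\<^sup>L circ (\<lambda>k. (norm (f k))\<^sup>2)"
    if "finite X" for X
  proof -
    have "(\<Sum>x\<in>X. (norm (fourier_inv f x))\<^sup>2) \<le> 1 / (2 * pi) * integral\<^sup>L circ (\<lambda>k. (norm (f k $ 1))\<^sup>2)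
        + 1 / (2 * pi) * integral\<^sup>L circ (\<lambda>k. (norm (f k $ 2))\<^sup>2)"
      unfolding norm_sq_vec2 sum.distrib fourier_inv_nth
      by (intro add_mono bessel_circ_finite L2_circ_nth assms that)
    then show ?thesis
      unfolding norm_sq_vec2 using L2_circ_nth(2)[OF assms] by (simp add: ring_distribs add_divide_distrib)
  qed
  show l2: "in_l2 (fourier_inv f)"
    unfolding in_l2_def by (rule nonneg_bdd_above_summable_on) (auto intro!: bdd_aboveI2 *)
  show "l2_normsq (fourier_inv f) \<le> 1 / (2 * pi) * integral\<^sup>L circ (\<lambda>k. (norm (f k))\<^sup>2)"
    unfolding l2_normsq_def using l2 by (intro infsum_le_finite_sums *) (simp_all add: in_l2_def)
qed

lemma fourier_inv_diff:
  assumes "L2_circ f" "L2_circ g"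
  shows "fourier_inv (\<lambda>k. f k - g k) x = fourier_inv f x - fourier_inv g x"
  by (simp add: vec_eq_iff fourier_inv_nth right_diff_distrib diff_divide_distrib
      integrable_circ_exp_int_mult L2_circ_nth assms)

text \<open>The integrands differ at most at the null point 0. As \<open>f\<close> and
  \<open>g\<close> are arbitrary functions, this applies to \<open>exp_vel_fourier\<close> before
  its measurability is known.\<close>

lemma fourier_inv_cong_interior:
  assumes "\<And>k. 0 < k \<Longrightarrow> k < 2 * pi \<Longrightarrow> f k = g k"
  shows "fourier_inv f = fourier_inv g"
proof (intro ext iffD2[OF vec_eq_iff] allI)
  fix x i
  show "fourier_inv f x $ i = fourier_inv g x $ i"
    unfolding fourier_inv_def integral_circ[symmetric] set_lebesgue_integral_def
    by (simp, intro arg_cong2[where f="(/)"] refl integral_discrete_difference[where X="{0}"])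
       (auto simp: indicator_def assms)
qed

section \<open>The walk as a multiplication operator in momentum space\<close>

lemma L2_circ_norm_eq:
  assumes "L2_circ f" "g \<in> borel_measurable circ"
    and "\<And>k. norm (g k) = norm (f k)"
  shows "L2_circ g"
  using assms unfolding L2_circ_def by simp

lemma continuous_on_matrix_vector_mult:
  "continuous_on UNIV (\<lambda>p :: (complex ^ 2 ^ 2) \<times> (complex ^ 2). fst p *v snd p)"
  unfolding matrix_vector_mult_def by (intro continuous_intros)

lemma borel_measurable_matrix_vector_mult:
  fixes A :: "'a \<Rightarrow> complex ^ 2 ^ 2"
  assumes "A \<in> borel_measurable M" "f \<in> borel_measurable M"
  shows "(\<lambda>k. A k *v f k) \<in> borel_measurable M"
  using borel_measurable_continuous_Pair[OF assms continuous_on_matrix_vector_mult] .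

lemma continuous_on_Uhat: "continuous_on UNIV (Uhat C)"
proof -
  have "continuous_on UNIV (\<lambda>k. if i = 1 then exp (\<i> * complex_of_real k) else exp (- \<i> * complex_of_real k))"
    for i :: 2
    by (cases "i = 1") (auto intro!: continuous_intros)
  then show ?thesis
    unfolding Uhat_def by (intro continuous_on_vec_lambda continuous_on_mult continuous_on_const)
qed

lemma continuous_on_cadj: "continuous_on UNIV cadj"
  unfolding cadj_def by (intro continuous_intros)

lemma borel_measurable_Uhat: "(\<lambda>k. Uhat C k) \<in> borel_measurable circ"
  "(\<lambda>k. cadj (Uhat C k)) \<in> borel_measurable circ"
  by (intro borel_measurable_circ borel_measurable_continuous_onI continuous_on_Uhat,
     intro borel_measurable_circ borel_measurable_continuous_onI
      continuous_on_compose2[OF continuous_on_cadj continuous_on_Uhat] subset_UNIV)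

lemma L2_circ_Uhat:
  assumes "unitary2 C" "L2_circ f"
  shows "L2_circ (\<lambda>k. Uhat C k *v f k)" "L2_circ (\<lambda>k. cadj (Uhat C k) *v f k)"
  using assms(2)
  by (rule L2_circ_norm_eq; use assms in \<open>auto intro!: borel_measurable_matrix_vector_mult borel_measurable_Uhat
       norm_unitary2_mult unitary2_Uhat unitary2_cadj simp: L2_circ_def\<close>)+

text \<open>Serves to move one row of the coin, with entries \<open>a\<close> and \<open>b\<close>,
  under the integral.\<close>

lemma fourier_inv_linear_comb:
  assumes "L2_circ f"
  shows "a * fourier_inv f y $ 1 + b * fourier_inv f y $ 2 =
    1 / (2 * pi) * integral\<^sup>L circ (\<lambda>k. exp (\<i> * complex_of_real (k * real_of_int y)) * (a * f k $ 1 + b * f k $ 2))"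
proof -
  have "integral\<^sup>L circ (\<lambda>k. exp (\<i> * complex_of_real (k * real_of_int y)) * (a * f k $ 1 + b * f k $ 2)) =
    integral\<^sup>L circ (\<lambda>k. a * (exp (\<i> * complex_of_real (k * real_of_int y)) * f k $ 1)
       + b * (exp (\<i> * complex_of_real (k * real_of_int y)) * f k $ 2))"
    by (simp add: algebra_simps)
  also have "\<dots> = a * integral\<^sup>L circ (\<lambda>k. exp (\<i> * complex_of_real (k * real_of_int y)) * f k $ 1)
       + b * integral\<^sup>L circ (\<lambda>k. exp (\<i> * complex_of_real (k * real_of_int y)) * f k $ 2)"
    by (subst Bochner_Integration.integral_add)
       (auto intro!: integrable_mult_right integrable_circ_exp_int_mult L2_circ_nth assms)
  finally show ?thesis by (simp add: fourier_inv_nth algebra_simps add_divide_distrib)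
qed

text \<open>Evaluating at a neighbouring site multiplies the integrand by exp (i k) or exp (- i k),
  which are the diagonal phases of the symbol.\<close>

lemma walk_fourier_inv:
  assumes "L2_circ f"
  shows "walk C (fourier_inv f) = fourier_inv (\<lambda>k. Uhat C k *v f k)"
proof (intro ext iffD2[OF vec_eq_iff] allI)
  fix x and i :: 2
  have e: "exp (\<i> * complex_of_real (k * real_of_int (x + 1))) =
      exp (\<i> * complex_of_real (k * real_of_int x)) * exp (\<i> * complex_of_real k)"
    "exp (\<i> * complex_of_real (k * real_of_int (x - 1))) =
      exp (\<i> * complex_of_real (k * real_of_int x)) * exp (- \<i> * complex_of_real k)" for k
    by (simp_all add: algebra_simps flip: exp_add)
  show "walk C (fourier_inv f) x $ i = fourier_inv (\<lambda>k. Uhat C k *v f k) x $ i"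
  proof (cases "i = 1")
    case True
    then have "walk C (fourier_inv f) x $ i =
        C $ 1 $ 1 * fourier_inv f (x + 1) $ 1 + C $ 1 $ 2 * fourier_inv f (x + 1) $ 2"
      by (simp add: walk_def shift_def coin_op_def matrix_vector_mult_def sum_2)
    then show ?thesis
      unfolding fourier_inv_linear_comb[OF assms] e unfolding fourier_inv_nth
      by (simp add: True matrix_vector_mult_def Uhat_def sum_2 algebra_simps)
  next
    case False
    then have i: "i = 2" using exhaust_2 by blast
    then have "walk C (fourier_inv f) x $ i =
        C $ 2 $ 1 * fourier_inv f (x - 1) $ 1 + C $ 2 $ 2 * fourier_inv f (x - 1) $ 2"
      by (simp add: walk_def shift_def coin_op_def matrix_vector_mult_def sum_2)
    then show ?thesis
      unfolding fourier_inv_linear_comb[OF assms] e unfolding fourier_inv_nth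
      by (simp add: i matrix_vector_mult_def Uhat_def sum_2 algebra_simps)
  qed
qed

lemma walk_inv_walk:
  assumes "unitary2 C"
  shows "walk_inv C (walk C \<Psi>) = \<Psi>"
proof -
  have "shift_inv (shift \<Phi>) = \<Phi>" for \<Phi>
    by (simp add: shift_inv_def shift_def fun_eq_iff vec_eq_iff forall_2)
  then show ?thesis
    using assms by (simp add: walk_inv_def walk_def coin_op_def fun_eq_iff matrix_vector_mul_assoc unitary2_def)
qed

text \<open>The forward walk maps the claimed right-hand side to \<open>fourier_inv f\<close>;
  applying the left inverse \<open>walk_inv C\<close> gives the formula.\<close>

lemma walk_inv_fourier_inv:
  assumes "unitary2 C" "L2_circ f"
  shows "walk_inv C (fourier_inv f) = fourier_inv (\<lambda>k. cadj (Uhat C k) *v f k)"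
proof -
  have "walk C (fourier_inv (\<lambda>k. cadj (Uhat C k) *v f k)) = fourier_inv f"
    using unitary2_Uhat[OF assms(1)]
    by (subst walk_fourier_inv[OF L2_circ_Uhat(2)[OF assms]]) (simp add: matrix_vector_mul_assoc unitary2_def)
  then show ?thesis by (metis walk_inv_walk assms(1))
qed

lemma funpow_walk_fourier_inv:
  assumes "unitary2 C" "L2_circ f"
  shows "L2_circ (\<lambda>k. ((*v) (Uhat C k) ^^ t) (f k)) \<and>
    (walk C ^^ t) (fourier_inv f) = fourier_inv (\<lambda>k. ((*v) (Uhat C k) ^^ t) (f k))"
  by (induction t) (use assms in \<open>auto simp: walk_fourier_inv L2_circ_Uhat\<close>)

lemma funpow_walk_inv_fourier_inv:
  assumes "unitary2 C" "L2_circ f"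
  shows "L2_circ (\<lambda>k. ((*v) (cadj (Uhat C k)) ^^ t) (f k)) \<and>
    (walk_inv C ^^ t) (fourier_inv f) = fourier_inv (\<lambda>k. ((*v) (cadj (Uhat C k)) ^^ t) (f k))"
  by (induction t) (use assms in \<open>auto simp: walk_inv_fourier_inv L2_circ_Uhat\<close>)

subsection \<open>Powers of unitary matrices near an eigenvector\<close>

lemma tendsto_scaled_increment:
  fixes h :: "real \<Rightarrow> 'a :: real_normed_vector"
  assumes "(h has_vector_derivative D) (at 0)" "h 0 = 0"
  shows "(\<lambda>t. real t *\<^sub>R h (\<xi> / real t)) \<longlonglongrightarrow> \<xi> *\<^sub>R D"
\<comment> \<open>For \<xi> = 0 the points \<open>\<xi> / real t\<close> never leave 0, so the
  punctured limit defining the derivative cannot be composed with them.\<close>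
proof (cases "\<xi> = 0")
  case True
  then show ?thesis using assms(2) by simp
next
  case False
  have s: "filterlim (\<lambda>t. \<xi> / real t) (at 0) sequentially"
    using tendsto_divide_nat False
    by (auto simp: filterlim_at eventually_sequentially intro!: exI[of _ 1])
  have "((\<lambda>s. norm (h s - s *\<^sub>R D) / \<bar>s\<bar>) \<longlongrightarrow> 0) (at 0)"
    using assms unfolding has_vector_derivative_def has_derivative_at by simp
  from tendsto_mult_right_zero[OF filterlim_compose[OF this s], of "\<bar>\<xi>\<bar>"]
  have lim: "(\<lambda>t. \<bar>\<xi>\<bar> * (norm (h (\<xi> / real t) - (\<xi> / real t) *\<^sub>R D) / \<bar>\<xi> / real t\<bar>)) \<longlonglongrightarrow> 0" .
  have "(\<lambda>t. norm (real t *\<^sub>R h (\<xi> / real t) - \<xi> *\<^sub>R D)) \<longlonglongrightarrow> 0"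
  proof (rule Lim_transform_eventually[OF lim])
    show "\<forall>\<^sub>F t in sequentially. \<bar>\<xi>\<bar> * (norm (h (\<xi> / real t) - (\<xi> / real t) *\<^sub>R D) / \<bar>\<xi> / real t\<bar>)
        = norm (real t *\<^sub>R h (\<xi> / real t) - \<xi> *\<^sub>R D)"
      using eventually_gt_at_top[of 0]
    proof eventually_elim
      case (elim t)
      have "real t *\<^sub>R h (\<xi> / real t) - \<xi> *\<^sub>R D = real t *\<^sub>R (h (\<xi> / real t) - (\<xi> / real t) *\<^sub>R D)"
        using elim by (simp add: scaleR_diff_right)
      then have "norm (real t *\<^sub>R h (\<xi> / real t) - \<xi> *\<^sub>R D) = real t * norm (h (\<xi> / real t) - (\<xi> / real t) *\<^sub>R D)"
        by (metis norm_scaleR abs_of_nat)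
      then show ?case using elim False by simp
    qed
  qed
  then show ?thesis by (simp add: LIM_zero_iff tendsto_norm_zero_iff)
qed

text \<open>With r(s) = l(k + s) / l(k), the power is exp (t Ln r(\<xi> / t)). Since r(0) = 1, Ln is
  differentiable there, and the chain rule gives Ln r the derivative l' / l(k) at 0.\<close>

lemma tendsto_power_increment:
  fixes l :: "real \<Rightarrow> complex"
  assumes l: "(l has_vector_derivative l') (at k)" and nz: "l k \<noteq> 0"
  shows "(\<lambda>t. (l (k + \<xi> / real t) / l k) ^ t) \<longlonglongrightarrow> exp (\<xi> * l' / l k)"
proof -
  define r where "r s = l (k + s) / l k" for s
  have "((\<lambda>s. l (k + s)) has_vector_derivative l') (at 0)"
  proof -
    have "((\<lambda>s. k + s) has_vector_derivative 1) (at 0)"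
      unfolding has_vector_derivative_def by (auto intro!: derivative_eq_intros)
    from vector_diff_chain_at[OF this, of l l'] show ?thesis using l by (simp add: o_def)
  qed
  then have r: "(r has_vector_derivative l' / l k) (at 0)"
    unfolding r_def by (intro has_vector_derivative_divide)
  have r0: "r 0 = 1" using nz by (simp add: r_def)
  have "((Ln \<circ> r) has_vector_derivative (l' / l k * 1)) (at 0)"
    by (rule field_vector_diff_chain_at[OF r]) (auto simp: r0 intro!: derivative_eq_intros)
  then have "(\<lambda>t. real t *\<^sub>R (Ln \<circ> r) (\<xi> / real t)) \<longlonglongrightarrow> \<xi> *\<^sub>R (l' / l k * 1)"
    by (rule tendsto_scaled_increment) (simp add: r0)
  from tendsto_exp[OF this]
  have lim: "(\<lambda>t. exp (real t *\<^sub>R Ln (r (\<xi> / real t)))) \<longlonglongrightarrow> exp (\<xi> * l' / l k)"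
    by (simp add: scaleR_conv_of_real)
  have "isCont r 0" using has_vector_derivative_continuous[OF r] .
  then have "(\<lambda>t. r (\<xi> / real t)) \<longlonglongrightarrow> 1"
    using isCont_tendsto_compose[OF _ tendsto_divide_nat] r0 by metis
  then have "\<forall>\<^sub>F t in sequentially. r (\<xi> / real t) \<noteq> 0"
    by (rule tendsto_imp_eventually_ne) simp
  \<comment> \<open>The logarithm inverts correctly only where \<open>r\<close> is nonzero, which
    holds for all large \<open>t\<close>.\<close>
  then have "\<forall>\<^sub>F t in sequentially. exp (real t *\<^sub>R Ln (r (\<xi> / real t))) = (l (k + \<xi> / real t) / l k) ^ t"
    by eventually_elim (simp add: scaleR_conv_of_real exp_of_nat_mult r_def)
  then show ?thesis by (rule Lim_transform_eventually[OF lim])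
qed

lemma cadj_eigenvector:
  assumes "unitary2 A" "A *v w = c *s w" "norm c = 1"
  shows "cadj A *v w = inverse c *s w"
proof -
  have "w = cadj A *v (A *v w)" using assms(1) by (simp add: matrix_vector_mul_assoc unitary2_def)
  also have "\<dots> = c *s (cadj A *v w)" by (simp add: assms(2) vector_scalar_commute)
  finally have "inverse c *s w = inverse c *s (c *s (cadj A *v w))" by simp
  moreover have "c \<noteq> 0" using assms(3) by auto
  ultimately show ?thesis by simp
qed

text \<open>Replacing \<open>w k\<close> by the nearby eigenvector \<open>w (k + \<xi> / t)\<close> costs an error which the powers
  do not amplify, as all matrices involved are unitary; so mere continuity of \<open>w\<close> suffices.\<close>
lemma tendsto_eigenvector_evolution:
  fixes A :: "real \<Rightarrow> complex ^ 2 ^ 2"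
  assumes S: "open S" "k \<in> S"
    and unitary: "\<And>s. s \<in> S \<Longrightarrow> unitary2 (A s)"
    and eigen: "\<And>s. s \<in> S \<Longrightarrow> A s *v w s = l s *s w s"
    and norm1: "\<And>s. s \<in> S \<Longrightarrow> norm (l s) = 1"
    and l: "(l has_vector_derivative l') (at k)" and w: "isCont w k"
  shows "(\<lambda>t. ((*v) (cadj (A k)) ^^ t) (((*v) (A (k + \<xi> / real t)) ^^ t) (w k)))
    \<longlonglongrightarrow> exp (\<xi> * l' / l k) *s w k"
proof -
  define x where "x t = ((*v) (cadj (A k)) ^^ t) (((*v) (A (k + \<xi> / real t)) ^^ t) (w k))" for t
  define y where "y t = (l (k + \<xi> / real t) / l k) ^ t *s w k" for t
  have s: "(\<lambda>t. k + \<xi> / real t) \<longlonglongrightarrow> k"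
    using tendsto_add[OF tendsto_const tendsto_divide_nat] by simp
  have ev: "\<forall>\<^sub>F t in sequentially. norm (x t - y t) \<le> 2 * norm (w k - w (k + \<xi> / real t))"
    using topological_tendstoD[OF s S]
  proof eventually_elim
    case (elim t)
    let ?s = "k + \<xi> / real t"
    let ?W = "(*v) (cadj (A k)) ^^ t" and ?B = "(*v) (A ?s) ^^ t"
    let ?d = "w k - w ?s"
    have W_w: "?W (w k) = inverse (l k) ^ t *s w k"
      by (rule funpow_matrix_eigen) (rule cadj_eigenvector[OF unitary eigen norm1]; fact)
    \<comment> \<open>Split \<open>w k\<close> as \<open>w ?s + ?d\<close>: the first summand is an
      exact eigenvector of \<open>A ?s\<close>, so it cancels and only the increment
      \<open>?d\<close> contributes.\<close>
    have "?B (w k) - l ?s ^ t *s w k = ?B ?d - l ?s ^ t *s ?d"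
      by (simp add: funpow_matrix_diff funpow_matrix_eigen[OF eigen[OF elim]] vector_ssub_ldistrib)
    then have "?W (?B ?d - l ?s ^ t *s ?d) = x t - l ?s ^ t *s (inverse (l k) ^ t *s w k)"
      by (metis x_def funpow_matrix_diff funpow_matrix_scale W_w)
    also have "l ?s ^ t *s (inverse (l k) ^ t *s w k) = y t"
      by (simp add: y_def vector_smult_assoc power_divide divide_inverse power_mult_distrib power_inverse)
    finally have "norm (x t - y t) = norm (?B ?d - l ?s ^ t *s ?d)"
      using norm_funpow_unitary2[OF unitary2_cadj[OF unitary[OF S(2)]]] by metis
    also have "\<dots> \<le> norm (?B ?d) + norm (l ?s ^ t *s ?d)" by (rule norm_triangle_ineq4)
    also have "\<dots> = 2 * norm ?d"
      by (simp del: vector_ssub_ldistrib add: norm_funpow_unitary2[OF unitary[OF elim]] norm_vector_scalar_mult norm_power norm1[OF elim])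
    finally show ?case .
  qed
  have "(\<lambda>t. w k - w (k + \<xi> / real t)) \<longlonglongrightarrow> w k - w k"
    by (intro tendsto_intros isCont_tendsto_compose[OF w s])
  then have "(\<lambda>t. 2 * norm (w k - w (k + \<xi> / real t))) \<longlonglongrightarrow> 0"
    by (auto intro: tendsto_mult_right_zero tendsto_norm_zero)
  then have xy: "(\<lambda>t. x t - y t) \<longlonglongrightarrow> 0"
    by (rule Lim_null_comparison[OF ev])
  have "l k \<noteq> 0" using norm1[OF S(2)] by auto
  then have "y \<longlonglongrightarrow> exp (\<xi> * l' / l k) *s w k"
    unfolding y_def vector_scalar_mult_def
    by (intro tendsto_vec_lambda tendsto_mult_right tendsto_power_increment[OF l])
  from tendsto_add[OF xy this] show ?thesis by (simp add: x_def)
qed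

text \<open>For the matrix \<open>Q\<close> with columns \<open>a\<close> and \<open>b\<close>,
  orthonormality is \<open>cadj Q ** Q = mat 1\<close>; the reversed product is completeness, that
  is, the expansion.\<close>

lemma orthonormal_expansion:
  fixes a b :: "complex ^ 2"
  assumes "cinner a a = 1" "cinner b b = 1" "cinner a b = 0" "cinner b a = 0"
  shows "v = cinner a v *s a + cinner b v *s b"
proof -
  define Q :: "complex ^ 2 ^ 2" where "Q = (\<chi> i m. if m = 1 then a $ i else b $ i)"
  have "cadj Q ** Q = mat 1"
    using assms by (simp add: vec_eq_iff forall_2 matrix_matrix_mult_def cadj_def Q_def sum_2 mat_def cinner_def)
  then have "Q ** cadj Q = mat 1" using matrix_left_right_inverse by metis
  then have "v = Q *v (cadj Q *v v)" by (simp add: matrix_vector_mul_assoc)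
  also have "\<dots> = cinner a v *s a + cinner b v *s b"
    by (simp add: vec_eq_iff matrix_vector_mult_def cadj_def Q_def sum_2 cinner_def algebra_simps)
  finally show ?thesis .
qed

text \<open>Every square-summable state is \<open>fourier_inv f\<close> for some square-integrable
  \<open>f\<close>, so convergence for all such \<open>f\<close> is strong convergence. The first
  conjunct ensures that \<open>l2_normsq\<close> is a true norm and not the default value 0 of a
  divergent sum.\<close>

theorem theorem2p3:
  fixes C0 :: "complex ^ 2 ^ 2"
    and lam lam' :: "nat \<Rightarrow> real \<Rightarrow> complex"
    and u u' :: "nat \<Rightarrow> real \<Rightarrow> complex ^ 2"
    and \<xi> :: real
    and f :: "real \<Rightarrow> complex ^ 2"
  assumes unitary: "unitary2 C0"
    and spectral: "\<And>k i j. k \<in> {0..<2*pi} \<Longrightarrow>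
         Uhat C0 k $ i $ j = (\<Sum>m\<in>{1,2}. lam m k * u m k $ i * cnj (u m k $ j))"
    and orthonormal: "\<And>k m n. k \<in> {0..<2*pi} \<Longrightarrow> m \<in> {1,2} \<Longrightarrow> n \<in> {1,2} \<Longrightarrow>
         cinner (u m k) (u n k) = (if m = n then 1 else 0)"
    and lam_abs: "\<And>k m. k \<in> {0..<2*pi} \<Longrightarrow> m \<in> {1,2} \<Longrightarrow> norm (lam m k) = 1"
    and lam_deriv: "\<And>k m. k \<in> {0..<2*pi} \<Longrightarrow> m \<in> {1,2} \<Longrightarrow>
         (lam m has_vector_derivative lam' m k) (at k within {0..<2*pi})"
    and A2_deriv: "\<And>k m. k \<in> {0..<2*pi} \<Longrightarrow> m \<in> {1,2} \<Longrightarrow>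
         (u m has_vector_derivative u' m k) (at k within {0..<2*pi})"
    and A2_cont: "\<And>m. m \<in> {1,2} \<Longrightarrow> continuous_on {0..<2*pi} (u' m)"
    and A2_bound: "\<And>m. m \<in> {1,2} \<Longrightarrow> bounded (u' m ` {0..<2*pi})"
    and f_L2: "sq_integrable f"
  shows "(\<forall>t. in_l2 (\<lambda>x. exp_pos_heis C0 \<xi> t (fourier_inv f) x
                          - fourier_inv (exp_vel_fourier lam lam' u \<xi> f) x))
    \<and> (\<lambda>t. l2_normsq (\<lambda>x. exp_pos_heis C0 \<xi> t (fourier_inv f) x
                          - fourier_inv (exp_vel_fourier lam lam' u \<xi> f) x)) \<longlonglongrightarrow> 0"
proof -
  have f: "L2_circ f" by (rule L2_circ_sq_integrable[OF f_L2])
  define \<psi> where "\<psi> = fourier_inv f"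
  define Ct where "Ct t = Uhat C0 (- \<xi> / real t)" for t
  define V where "V = exp_vel_symbol lam lam' u \<xi>"
  define A where "A t k v = ((*v) (cadj (Uhat C0 k)) ^^ t) (((*v) (Uhat C0 (k + (- \<xi>) / real t)) ^^ t) v)" for t k v
  \<comment> \<open>The cutoff makes \<open>V0\<close> an everywhere pointwise limit of measurable
    functions, from which it inherits measurability and the bound by
    \<open>norm (f k)\<close>.\<close>
  define V0 where "V0 k = indicator {0<..<2*pi} k *\<^sub>R (V k *v f k)" for k
  define D where "D t x = exp_pos \<xi> (real t) \<psi> x - \<psi> x" for t x
  have uCt: "unitary2 (Ct t)" for t unfolding Ct_def by (rule unitary2_Uhat[OF unitary])
  have norm_A: "norm (A t k v) = norm v" for t k v
    unfolding A_def by (simp add: norm_funpow_unitary2 unitary2_cadj unitary2_Uhat unitary)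

  \<comment> \<open>Pointwise limit of the momentum symbols\<close>
  have eigen: "Uhat C0 k *v u n k = lam n k *s u n k" if "k \<in> {0..<2*pi}" "n \<in> {1,2}" for k n
  proof -
    have "(Uhat C0 k *v u n k) $ i = (\<Sum>m\<in>{1,2}. lam m k * u m k $ i * cinner (u m k) (u n k))" for i
      by (simp add: matrix_vector_mult_def spectral[OF that(1)] sum_2 cinner_def algebra_simps)
    then show ?thesis using that by (auto simp: vec_eq_iff orthonormal)
  qed
  have lim_A: "(\<lambda>t. A t k v) \<longlonglongrightarrow> V k *v v" if k: "0 < k" "k < 2 * pi" for k v
  proof -
    have k': "k \<in> {0..<2*pi}" using k by auto
    \<comment> \<open>The translation by \<open>- \<xi> / t\<close> may go to either side of
      \<open>k\<close>, so two-sided derivatives are required; they are available at interior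
      points.\<close>
    have at_eq: "at k within {0..<2*pi} = at k"
      by (rule at_within_interior) (use k in \<open>simp add: interior_atLeastLessThan\<close>)
    have lim_u: "(\<lambda>t. A t k (u n k)) \<longlonglongrightarrow> exp ((- \<xi>) * lam' n k / lam n k) *s u n k" if n: "n \<in> {1,2}" for n
      unfolding A_def
    proof (rule tendsto_eigenvector_evolution[of "{0<..<2*pi}" k "Uhat C0" "u n" "lam n" "lam' n k" "- \<xi>"])
      show "isCont (u n) k"
        using has_vector_derivative_continuous[OF A2_deriv[OF k' n]] by (simp add: at_eq)
    qed (use k n lam_deriv[OF k' n] in \<open>auto simp: at_eq intro!: unitary2_Uhat unitary eigen lam_abs\<close>)
    let ?c = "\<lambda>n. cinner (u n k) v"
    have v: "v = ?c 1 *s u 1 k + ?c 2 *s u 2 k"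
      by (rule orthonormal_expansion) (simp_all add: orthonormal[OF k'])
    have "A t k v = ?c 1 *s A t k (u 1 k) + ?c 2 *s A t k (u 2 k)" for t
      by (subst v) (simp add: A_def funpow_matrix_add funpow_matrix_scale)
    \<comment> \<open>The exponents match because i \<xi> (i lam' / lam) = - \<xi> lam' /
      lam.\<close>
    moreover have "V k *v v = ?c 1 *s (exp ((- \<xi>) * lam' 1 k / lam 1 k) *s u 1 k)
        + ?c 2 *s (exp ((- \<xi>) * lam' 2 k / lam 2 k) *s u 2 k)"
      by (simp add: V_def exp_vel_symbol_def vec_eq_iff matrix_vector_mult_def sum_2 cinner_def algebra_simps)
    moreover have "(\<lambda>t. ?c n *s A t k (u n k)) \<longlonglongrightarrow> ?c n *s (exp ((- \<xi>) * lam' n k / lam n k) *s u n k)"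
      if "n \<in> {1,2}" for n
      unfolding vector_scalar_mult_def[of "?c n"]
      by (intro tendsto_vec_lambda tendsto_mult_left tendsto_vec_nth lim_u that)
    ultimately show ?thesis by (simp add: tendsto_add)
  qed

  \<comment> \<open>Evolution in momentum space and the limit symbol\<close>
  have walk: "L2_circ (\<lambda>k. A t k (f k)) \<and>
      (walk_inv C0 ^^ t) ((walk (Ct t) ^^ t) \<psi>) = fourier_inv (\<lambda>k. A t k (f k))" for t
    using funpow_walk_fourier_inv[OF uCt f, of t t] funpow_walk_inv_fourier_inv[OF unitary]
    by (simp add: \<psi>_def A_def Ct_def Uhat_Uhat)
  have meas_A: "(\<lambda>k. indicator {0<..<2*pi} k *\<^sub>R A t k (f k)) \<in> borel_measurable circ" for t
  proof (rule borel_measurable_scaleR)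
    show "indicat_real {0<..<2*pi} \<in> borel_measurable circ" by (intro borel_measurable_circ) auto
  qed (use walk[of t] in \<open>simp add: L2_circ_def\<close>)
  have lim_V0: "(\<lambda>t. indicator {0<..<2*pi} k *\<^sub>R A t k (f k)) \<longlonglongrightarrow> V0 k" for k
    unfolding V0_def using lim_A by (auto simp: indicator_def)
  have meas_V0: "V0 \<in> borel_measurable circ"
    by (rule borel_measurable_LIMSEQ_metric[OF meas_A lim_V0])
  have norm_V0: "norm (V0 k) \<le> norm (f k)" for k
    by (rule LIMSEQ_le_const2[OF tendsto_norm[OF lim_V0]]) (auto simp: norm_A indicator_def)
  have V0: "L2_circ V0"
    unfolding L2_circ_def
  proof (intro conjI meas_V0)
    show "integrable circ (\<lambda>k. (norm (V0 k))\<^sup>2)"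
    proof (rule Bochner_Integration.integrable_bound)
      show "integrable circ (\<lambda>k. (norm (f k))\<^sup>2)" using f by (simp add: L2_circ_def)
    qed (use meas_V0 norm_V0 in \<open>auto intro: power_mono\<close>)
  qed
  have V_V0: "fourier_inv (exp_vel_fourier lam lam' u \<xi> f) = fourier_inv V0"
    by (rule fourier_inv_cong_interior) (simp add: V0_def V_def exp_vel_fourier_def)

  \<comment> \<open>Dominated convergence of the momentum error\<close>
  have bound: "(norm (A t k (f k) - V0 k))\<^sup>2 \<le> 4 * (norm (f k))\<^sup>2" for t k
  proof -
    have "(norm (V0 k))\<^sup>2 \<le> (norm (f k))\<^sup>2" by (intro power_mono norm_V0) simp
    then show ?thesis using norm_diff_sq_le[of "A t k (f k)" "V0 k"] unfolding norm_A by linarith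
  qed
  have meas_diff: "(\<lambda>k. A t k (f k) - V0 k) \<in> borel_measurable circ" for t
    using walk[of t] meas_V0 by (auto simp: L2_circ_def)
  have int4: "integrable circ (\<lambda>k. 4 * (norm (f k))\<^sup>2)" using f by (simp add: L2_circ_def)
  have L2_diff: "L2_circ (\<lambda>k. A t k (f k) - V0 k)" for t
    unfolding L2_circ_def
    by (intro conjI meas_diff Bochner_Integration.integrable_bound[OF int4])
       (use meas_diff[of t] bound in auto)
  have lim_int: "(\<lambda>t. integral\<^sup>L circ (\<lambda>k. (norm (A t k (f k) - V0 k))\<^sup>2)) \<longlonglongrightarrow> integral\<^sup>L circ (\<lambda>k. 0)"
  proof (rule integral_dominated_convergence[OF _ _ int4])
    show "AE k in circ. (\<lambda>t. (norm (A t k (f k) - V0 k))\<^sup>2) \<longlonglongrightarrow> 0"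
      using AE_circ_interior
    proof eventually_elim
      case (elim k)
      then have "(\<lambda>t. (norm (A t k (f k) - V0 k))\<^sup>2) \<longlonglongrightarrow> (norm (V k *v f k - V0 k))\<^sup>2"
        by (intro tendsto_intros lim_A) auto
      then show ?case using elim by (simp add: V0_def)
    qed
  qed (use meas_diff bound in auto)

  \<comment> \<open>The position error and the combined estimate\<close>
  have \<psi>: "in_l2 \<psi>" unfolding \<psi>_def by (rule bessel_fourier_inv(1)[OF f])
  have D: "in_l2 (D t)" for t unfolding D_def by (intro l2_diff l2_exp_pos \<psi>)
  have lim_D: "(\<lambda>t. l2_normsq (D t)) \<longlonglongrightarrow> 0"
    using exp_pos_tendsto[OF \<psi>] by (simp only: D_def[abs_def])
  define E where "E t = (walk_inv C0 ^^ t) ((walk (Ct t) ^^ t) (D t))" for t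
  have E: "in_l2 (E t) \<and> l2_normsq (E t) = l2_normsq (D t)" for t
    using l2_funpow_walk[OF uCt D, of t t] l2_funpow_walk_inv[OF unitary] unfolding E_def by metis
  \<comment> \<open>Conjugation turns the evolved state into \<open>walk (Ct t)\<close> iterated on
    \<open>exp_pos \<xi> (real t) \<psi>\<close>. Writing this argument as \<psi> plus
    \<open>D t\<close> separates an isometric image of \<open>D t\<close> from a pure momentum
    multiplier.\<close>
  have split: "exp_pos_heis C0 \<xi> t \<psi> x - fourier_inv V0 x = E t x + fourier_inv (\<lambda>k. A t k (f k) - V0 k) x" for t x
  proof -
    have "E t x = exp_pos_heis C0 \<xi> t \<psi> x - fourier_inv (\<lambda>k. A t k (f k)) x"
      using walk[of t]
      by (simp add: E_def D_def[abs_def] funpow_walk_diff funpow_walk_inv_diff exp_pos_heis_def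
          exp_pos_funpow_walk Ct_def)
    then show ?thesis by (simp add: fourier_inv_diff walk V0)
  qed
  let ?R = "\<lambda>t x. exp_pos_heis C0 \<xi> t \<psi> x - fourier_inv V0 x"
  let ?I = "\<lambda>t. integral\<^sup>L circ (\<lambda>k. (norm (A t k (f k) - V0 k))\<^sup>2)"
  have R: "in_l2 (?R t)" "l2_normsq (?R t) \<le> 2 * l2_normsq (D t) + 2 * (1 / (2 * pi) * ?I t)" for t
    using l2_add[of "E t" "fourier_inv (\<lambda>k. A t k (f k) - V0 k)"] E[of t] bessel_fourier_inv[OF L2_diff[of t]]
    unfolding split by auto
  have "(\<lambda>t. 2 * l2_normsq (D t) + 2 * (1 / (2 * pi) * ?I t)) \<longlonglongrightarrow> 2 * 0 + 2 * (1 / (2 * pi) * integral\<^sup>L circ (\<lambda>k. 0))"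
    by (intro tendsto_intros lim_int lim_D)
  then have lim: "(\<lambda>t. 2 * l2_normsq (D t) + 2 * (1 / (2 * pi) * ?I t)) \<longlonglongrightarrow> 0" by simp
  have "(\<lambda>t. l2_normsq (?R t)) \<longlonglongrightarrow> 0"
    by (rule tendsto_sandwich[OF _ _ tendsto_const lim])
       (use R in \<open>auto simp: l2_normsq_def intro!: infsum_nonneg always_eventually\<close>)
  then show ?thesis using R(1) unfolding V_V0 \<psi>_def by blast
qed

end
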